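(* Let $p$ be a rational number with $0<p\le\tfrac12$. The set of $\Sigma$-countermonotonic probability mass functions in $\mathcal{F}_3(p)$ is a convex polytope whose generators (extremal points) are all the extremal points of $\mathcal{F}_3(p)$ that are $\Sigma_{cx}$-smallest elements of $\mathcal{F}_3(p)$. Writing pmfs $f$ on $\{0,1\}^3$ as vectors $$(f(0,0,0),f(1,0,0),f(0,1,0),f(1,1,0),f(0,0,1),f(1,0,1),f(0,1,1),f(1,1,1)),$$ these generators are: (1) if $p\le\tfrac13$: the single pmf $(1-3p,\,p,\,p,\,0,\,p,\,0,\,0,\,0)$; (2) if $\tfrac13<p\le\tfrac12$: the three pmfs $$\begin{aligned} \boldsymbol r_6&=(0,\,1-2p,\,1-2p,\,3p-1,\,p,\,0,\,0,\,0),\\ \boldsymbol r_7&=(0,\,1-2p,\,p,\,0,\,1-2p,\,3p-1,\,0,\,0),\\ \boldsymbol r_8&=(0,\,p,\,1-2p,\,0,\,1-2p,\,0,\,3p-1,\,0). \end{aligned}$$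
   Context: $\mathcal{F}_3(p)$ is the convex polytope of probability mass functions $f$ on $\{0,1\}^3$ such that a random vector $\boldsymbol X=(X_1,X_2,X_3)$ with pmf $f$ has $E[X_i]=p$ for $i=1,2,3$ (i.e. all marginals are Bernoulli of mean $p$). Its extremal points are its extreme points (vertices). A bivariate random vector $(X,Y)$ is countermonotonic if $\mathbb{P}\{(X_1-X_2)(Y_1-Y_2)\le 0\}=1$, where $(X_1,Y_1)$ and $(X_2,Y_2)$ are independent copies of $(X,Y)$. A $d$-dimensional random vector $\boldsymbol Y=(Y_1,\dots,Y_d)$ is $\Sigma$-countermonotonic if for every $J\subseteq\{1,\dots,d\}$ the pair $(\sum_{j\in J}Y_j,\sum_{j\notin J}Y_j)$ is countermonotonic, with $\sum_{j\in\emptyset}Y_j=0$. A pmf is called $\Sigma$-countermonotonic if a random vector with that pmf is. For random variables $Y_1,Y_2$ with finite means, $Y_1\le_{cx}Y_2$ (convex order) means $E\{\phi(Y_1)\}\le E\{\phi(Y_2)\}$ for all real-valued convex $\phi$ for which the expectations are finite. A $\Sigma_{cx}$-smallest element of a class of distributions $\mathcal{F}$ is a random vector $\boldsymbol Y$ (or its distribution) with distribution in $\mathcal{F}$ such that $\sum_{j}Y_j\le_{cx}\sum_j Y'_j$ for every random vector $\boldsymbol Y'$ with distribution in $\mathcal{F}$. *)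

theory Defs
  imports "HOL-Probability.Probability"
begin

text \<open>
  The two coordinate projections of the product space \<open>M \<Otimes>\<^sub>M M\<close> serve as the source of
  independent copies: \<open>(X (fst w), Y (fst w))\<close> and \<open>(X (snd w), Y (snd w))\<close> are independent
  copies of \<open>(X, Y)\<close>.
\<close>

definition countermonotonic :: "'w measure \<Rightarrow> ('w \<Rightarrow> real) \<Rightarrow> ('w \<Rightarrow> real) \<Rightarrow> bool" where
  "countermonotonic M X Y \<longleftrightarrow>
     \<P>(w in M \<Otimes>\<^sub>M M. (X (fst w) - X (snd w)) * (Y (fst w) - Y (snd w)) \<le> 0) = 1"

definition Sigma_countermonotonic :: "'w measure \<Rightarrow> ('w \<Rightarrow> real ^ 'n) \<Rightarrow> bool" where
  "Sigma_countermonotonic M Y \<longleftrightarrow>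
     (\<forall>J :: 'n set. countermonotonic M (\<lambda>w. \<Sum>j\<in>J. Y w $ j) (\<lambda>w. \<Sum>j\<in>- J. Y w $ j))"

text \<open>
  A joint distribution is represented by the canonical random vector, i.e. the identity map on
  the probability space \<open>measure_pmf f\<close>.
\<close>

definition Sigma_countermonotonic_pmf :: "(real ^ 'n) pmf \<Rightarrow> bool" where
  "Sigma_countermonotonic_pmf f \<longleftrightarrow> Sigma_countermonotonic (measure_pmf f) (\<lambda>x. x)"

text \<open>
  Only the laws of \<open>Y1\<close> and \<open>Y2\<close> matter, so they may live on different probability spaces.
\<close>

definition convex_order ::
  "'v measure \<Rightarrow> ('v \<Rightarrow> real) \<Rightarrow> 'w measure \<Rightarrow> ('w \<Rightarrow> real) \<Rightarrow> bool" where
  "convex_order M1 Y1 M2 Y2 \<longleftrightarrow>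
     integrable M1 Y1 \<and> integrable M2 Y2 \<and>
     (\<forall>\<phi> :: real \<Rightarrow> real. convex_on UNIV \<phi> \<longrightarrow>
        integrable M1 (\<lambda>w. \<phi> (Y1 w)) \<longrightarrow> integrable M2 (\<lambda>w. \<phi> (Y2 w)) \<longrightarrow>
        (\<integral>w. \<phi> (Y1 w) \<partial>M1) \<le> (\<integral>w. \<phi> (Y2 w) \<partial>M2))"

definition Sigma_cx_smallest :: "(real ^ 'n) pmf set \<Rightarrow> (real ^ 'n) pmf \<Rightarrow> bool" where
  "Sigma_cx_smallest F f \<longleftrightarrow> f \<in> F \<and>
     (\<forall>g\<in>F. convex_order (measure_pmf f) (\<lambda>x. \<Sum>j\<in>UNIV. x $ j)
                        (measure_pmf g) (\<lambda>x. \<Sum>j\<in>UNIV. x $ j))"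

definition bernoulli_class :: "real \<Rightarrow> (real ^ 'n) pmf set" where
  "bernoulli_class p =
     {f. set_pmf f \<subseteq> {x. \<forall>i. x $ i \<in> {0, 1}} \<and>
         (\<forall>i. measure_pmf.expectation f (\<lambda>x. x $ i) = p)}"

text \<open>
  The type of pmfs is not a vector space; convexity, polytopes and extreme points refer to the
  vectors of values of the pmfs, listed in colexicographical order (first coordinate varying fastest) of the points of
  \<open>{0,1}\<^sup>3\<close>. On pmfs supported in \<open>{0,1}\<^sup>3\<close> this encoding is injective.
\<close>

definition pmf_vec :: "(real ^ 3) pmf \<Rightarrow> real ^ 8" where
  "pmf_vec f = vector
     [pmf f (vector [0, 0, 0]), pmf f (vector [1, 0, 0]),
      pmf f (vector [0, 1, 0]), pmf f (vector [1, 1, 0]),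
      pmf f (vector [0, 0, 1]), pmf f (vector [1, 0, 1]),
      pmf f (vector [0, 1, 1]), pmf f (vector [1, 1, 1])]"

end

theory Submission
  imports Defs
begin

text \<open>
  Let \<open>k \<le> n p \<le> k + 1\<close>. For points \<open>x, y\<close> of \<open>{0,1}\<^sup>n\<close>, the partial sums of \<open>x - y\<close> over \<open>J\<close> and
  over its complement never have the same strict sign iff the coordinate sums of \<open>x\<close> and \<open>y\<close>
  differ by at most one: these partial sums are integers, and \<open>J = {i}\<close> with \<open>x\<^sub>i = 1\<close>, \<open>y\<^sub>i = 0\<close>
  violates the sign condition otherwise. Hence a member of the Bernoulli class is
  \<open>\<Sigma>\<close>-countermonotonic iff its sum is concentrated on \<open>{k, k + 1}\<close>. If such members exist, they
  are exactly the \<open>\<Sigma>\<^sub>c\<^sub>x\<close>-smallest ones, because a convex function dominates, at the integers,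
  its chord over \<open>[k, k + 1]\<close>. For \<open>n = 3\<close> they form a face of the polytope of the whole class:
  a point if \<open>p \<le> 1/3\<close>, and otherwise a triangle parametrised by the masses of the three points of
  weight two.
\<close>

section \<open>Countermonotonicity as a condition on supports\<close>

text \<open>Probability one on the product is an almost-everywhere statement, which splits into
  iterated ones over the two factors; for a pmf these range over the support.\<close>

lemma countermonotonic_measure_pmf_iff:
  "countermonotonic (measure_pmf f) X Y \<longleftrightarrow>
     (\<forall>x\<in>set_pmf f. \<forall>y\<in>set_pmf f. (X x - X y) * (Y x - Y y) \<le> 0)"
proof -
  let ?M = "measure_pmf f"
  interpret pair_prob_space ?M ?M ..
  have [measurable]: "X \<in> borel_measurable ?M" "Y \<in> borel_measurable ?M"
    by simp_all
  \<comment> \<open>The product sigma-algebra is generated by rectangles and may be smaller than the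
    power set, so measurability has to come from \<open>X\<close> and \<open>Y\<close>.\<close>
  have meas: "{w \<in> space (?M \<Otimes>\<^sub>M ?M). (X (fst w) - X (snd w)) * (Y (fst w) - Y (snd w)) \<le> 0}
      \<in> sets (?M \<Otimes>\<^sub>M ?M)"
    by measurable
  show ?thesis
    unfolding countermonotonic_def P.prob_Collect_eq_1[OF meas]
    by (subst AE_pair_iff[symmetric, OF meas]) (simp add: AE_measure_pmf_iff)
qed

abbreviation coord_sum :: "real ^ 'n \<Rightarrow> real" where
  "coord_sum x \<equiv> \<Sum>j\<in>UNIV. x $ j"

lemma sum_01_in_Ints:
  fixes x :: "real ^ 'n"
  assumes "\<forall>i. x $ i \<in> {0, 1}"
  shows "(\<Sum>j\<in>J. x $ j) \<in> \<int>"
proof (rule Ints_sum)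
  show "x $ i \<in> \<int>" for i
    using assms[rule_format, of i] by auto
qed

lemma all_partition_products_nonpos_iff:
  fixes x y :: "real ^ 'n"
  assumes x: "\<forall>i. x $ i \<in> {0, 1}" and y: "\<forall>i. y $ i \<in> {0, 1}"
  shows "(\<forall>J. ((\<Sum>j\<in>J. x $ j) - (\<Sum>j\<in>J. y $ j)) * ((\<Sum>j\<in>- J. x $ j) - (\<Sum>j\<in>- J. y $ j)) \<le> 0)
     \<longleftrightarrow> \<bar>coord_sum x - coord_sum y\<bar> \<le> 1" (is "(\<forall>J. ?A J * ?B J \<le> 0) \<longleftrightarrow> _")
proof
  have split: "(\<Sum>j\<in>J. z $ j) + (\<Sum>j\<in>- J. z $ j) = coord_sum z" for z :: "real ^ 'n" and J
    by (subst sum.union_disjoint[symmetric]) auto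
  {
    assume le: "\<bar>coord_sum x - coord_sum y\<bar> \<le> 1"
    show "\<forall>J. ?A J * ?B J \<le> 0"
    proof
      fix J
      have "?A J \<in> \<int>" "?B J \<in> \<int>"
        using x y by (auto intro!: Ints_diff sum_01_in_Ints)
      then obtain a b where ab: "?A J = of_int a" "?B J = of_int b"
        by (auto elim!: Ints_cases)
      have "coord_sum x - coord_sum y = of_int (a + b)"
        using split[where J=J and z=x] split[where J=J and z=y] ab by simp
      with le have "\<bar>of_int (a + b) :: real\<bar> \<le> 1"
        by simp
      then have "\<bar>a + b\<bar> \<le> 1"
        by linarith
      \<comment> \<open>Two integers of the same strict sign have a sum of absolute value at least
        2.\<close>
      then have "(a \<le> 0 \<and> 0 \<le> b) \<or> (0 \<le> a \<and> b \<le> 0)"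
        by linarith
      then have "a * b \<le> 0"
        by (auto simp: mult_le_0_iff)
      then show "?A J * ?B J \<le> 0"
        unfolding ab by (metis of_int_le_0_iff of_int_mult)
    qed
  }
  {
    \<comment> \<open>The sign condition is symmetric in the two points, so a one-sided bound, used
      in both orders, suffices.\<close>
    have aux: "coord_sum u - coord_sum v \<le> 1"
      if "\<And>J. ((\<Sum>j\<in>J. u $ j) - (\<Sum>j\<in>J. v $ j)) * ((\<Sum>j\<in>- J. u $ j) - (\<Sum>j\<in>- J. v $ j)) \<le> 0"
        and u: "\<forall>i. u $ i \<in> {0, 1}" and v: "\<forall>i. v $ i \<in> {0, 1}" for u v :: "real ^ 'n"
    proof (rule ccontr)
      assume gt: "\<not> coord_sum u - coord_sum v \<le> 1"
      have "\<exists>i. v $ i < u $ i"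
      proof (rule ccontr)
        assume "\<not> (\<exists>i. v $ i < u $ i)"
        then have "coord_sum u \<le> coord_sum v"
          by (intro sum_mono) (simp add: not_less)
        with gt show False by simp
      qed
      then obtain i where "v $ i < u $ i" ..
      moreover have "u $ i = 0 \<or> u $ i = 1" "v $ i = 0 \<or> v $ i = 1"
        using u v by auto
      ultimately have i: "u $ i = 1" "v $ i = 0"
        by auto
      \<comment> \<open>For \<open>J = {i}\<close> the first factor is 1, so the second is
        nonpositive.\<close>
      have "(\<Sum>j\<in>- {i}. u $ j) - (\<Sum>j\<in>- {i}. v $ j) \<le> 0"
        using that(1)[of "{i}"] i by simp
      moreover have "coord_sum u = 1 + (\<Sum>j\<in>- {i}. u $ j)" "coord_sum v = (\<Sum>j\<in>- {i}. v $ j)"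
        using split[of u "{i}"] split[of v "{i}"] i by auto
      ultimately show False
        using gt by linarith
    qed
    assume le: "\<forall>J. ?A J * ?B J \<le> 0"
    have "coord_sum x - coord_sum y \<le> 1"
      by (rule aux) (use le x y in auto)
    moreover have "coord_sum y - coord_sum x \<le> 1"
    proof (rule aux)
      fix J
      show "((\<Sum>j\<in>J. y $ j) - (\<Sum>j\<in>J. x $ j)) * ((\<Sum>j\<in>- J. y $ j) - (\<Sum>j\<in>- J. x $ j)) \<le> 0"
        using le[rule_format, of J] by (simp add: algebra_simps)
    qed (use x y in auto)
    ultimately show "\<bar>coord_sum x - coord_sum y\<bar> \<le> 1"
      by linarith
  }
qed

section \<open>Integrability and means in the Bernoulli class\<close>

lemma finite_01_vectors: "finite {x :: real ^ 'n. \<forall>i. x $ i \<in> {0, 1}}"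
proof (rule finite_imageD)
  show "finite ((\<lambda>x. {i. x $ i = 1}) ` {x :: real ^ 'n. \<forall>i. x $ i \<in> {0, 1}})"
    by (rule finite_subset[of _ "Pow UNIV"]) auto
  show "inj_on (\<lambda>x. {i. x $ i = 1}) {x :: real ^ 'n. \<forall>i. x $ i \<in> {0, 1}}"
  proof (rule inj_onI)
    fix x y :: "real ^ 'n"
    assume x: "x \<in> {x. \<forall>i. x $ i \<in> {0, 1}}" and y: "y \<in> {x. \<forall>i. x $ i \<in> {0, 1}}"
      and eq: "{i. x $ i = 1} = {i. y $ i = 1}"
    have "x $ i = y $ i" for i
    proof -
      have "x $ i = 0 \<or> x $ i = 1" "y $ i = 0 \<or> y $ i = 1" "x $ i = 1 \<longleftrightarrow> y $ i = 1"
        using x y eq by auto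
      then show ?thesis by auto
    qed
    then show "x = y"
      by (simp add: vec_eq_iff)
  qed
qed

lemma bernoulli_class_01:
  "f \<in> bernoulli_class p \<Longrightarrow> x \<in> set_pmf f \<Longrightarrow> \<forall>i. x $ i \<in> {0, 1}"
  unfolding bernoulli_class_def by auto

text \<open>The support is finite. This discharges the integrability premises of
  \<open>convex_order\<close> for every test function.\<close>

lemma bernoulli_class_integrable:
  fixes h :: "real ^ 'n \<Rightarrow> real"
  assumes "f \<in> bernoulli_class p"
  shows "integrable (measure_pmf f) h"
  using assms finite_subset[OF _ finite_01_vectors]
  by (intro integrable_measure_pmf_finite) (auto simp: bernoulli_class_def)

lemma bernoulli_class_expectation_coord_sum:
  fixes f :: "(real ^ 'n) pmf"
  assumes "f \<in> bernoulli_class p"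
  shows "measure_pmf.expectation f coord_sum = real CARD('n) * p"
  using assms by (simp add: bernoulli_class_integrable[OF assms] bernoulli_class_def)

lemma coord_sum_bernoulli_class:
  assumes "f \<in> bernoulli_class p" and "x \<in> set_pmf f"
  obtains s :: int where "coord_sum x = of_int s"
  using sum_01_in_Ints[OF bernoulli_class_01[OF assms], of UNIV] by (auto elim: Ints_cases)

text \<open>The excess \<open>h x - c\<close> is nonnegative with mean at most 0, so it vanishes
  almost everywhere, which for a pmf means on the whole support. Bounds on means thus become
  statements about supports.\<close>

lemma eq_on_set_pmf_if_expectation_le:
  fixes h :: "'a \<Rightarrow> real"
  assumes "integrable (measure_pmf f) h" and "\<And>x. x \<in> set_pmf f \<Longrightarrow> c \<le> h x"
    and "measure_pmf.expectation f h \<le> c" and "x \<in> set_pmf f"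
  shows "h x = c"
proof -
  have nonneg: "AE x in measure_pmf f. 0 \<le> h x - c"
    using assms(2) by (simp add: AE_measure_pmf_iff)
  have int: "measure_pmf.expectation f (\<lambda>x. h x - c) = measure_pmf.expectation f h - c"
    using assms(1) by simp
  have "0 \<le> measure_pmf.expectation f (\<lambda>x. h x - c)"
    using nonneg by (rule integral_nonneg_AE)
  then have "measure_pmf.expectation f (\<lambda>x. h x - c) = 0"
    using assms(3) int by linarith
  then have "AE x in measure_pmf f. h x - c = 0"
    using integral_nonneg_eq_0_iff_AE[OF _ nonneg] assms(1) by simp
  then show ?thesis
    using assms(4) by (simp add: AE_measure_pmf_iff)
qed

text \<open>
  If the sums differ by at most one and some sum lies outside \<open>{k, k + 1}\<close>, then all sums lie
  on the far side of \<open>k\<close> or \<open>k + 1\<close>, which contradicts the value of the mean.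
\<close>

lemma Sigma_countermonotonic_pmf_iff:
  fixes f :: "(real ^ 'n) pmf" and k :: int
  assumes f: "f \<in> bernoulli_class p" and lo: "of_int k \<le> real CARD('n) * p"
    and hi: "real CARD('n) * p \<le> of_int k + 1"
  shows "Sigma_countermonotonic_pmf f \<longleftrightarrow>
    (\<forall>x\<in>set_pmf f. coord_sum x \<in> {of_int k, of_int k + 1})"
proof -
  have "Sigma_countermonotonic_pmf f \<longleftrightarrow>
      (\<forall>x\<in>set_pmf f. \<forall>y\<in>set_pmf f. \<bar>coord_sum x - coord_sum y\<bar> \<le> 1)"
    unfolding Sigma_countermonotonic_pmf_def Sigma_countermonotonic_def
      countermonotonic_measure_pmf_iff
    using all_partition_products_nonpos_iff[OF bernoulli_class_01[OF f] bernoulli_class_01[OF f]]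
    by blast
  also have "\<dots> \<longleftrightarrow> (\<forall>x\<in>set_pmf f. coord_sum x \<in> {of_int k, of_int k + 1})"
  proof
    assume close: "\<forall>x\<in>set_pmf f. \<forall>y\<in>set_pmf f. \<bar>coord_sum x - coord_sum y\<bar> \<le> 1"
    show "\<forall>x\<in>set_pmf f. coord_sum x \<in> {of_int k, of_int k + 1}"
    proof (rule ballI, rule ccontr)
      fix x
      assume x: "x \<in> set_pmf f" and notin: "coord_sum x \<notin> {of_int k, of_int k + 1}"
      obtain s :: int where s: "coord_sum x = of_int s"
        using coord_sum_bernoulli_class[OF f x] .
      have "s \<noteq> k" "s \<noteq> k + 1"
        using notin s by auto
      then consider "s \<ge> k + 2" | "s \<le> k - 1"
        by linarith
      then show False
      proof cases
        case 1
        then have ge: "coord_sum x \<ge> of_int k + 2"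
          using s by simp
        have "coord_sum x = of_int k + 1"
        proof (rule eq_on_set_pmf_if_expectation_le[OF bernoulli_class_integrable[OF f] _ _ x])
          show "of_int k + 1 \<le> coord_sum y" if "y \<in> set_pmf f" for y
            using close[rule_format, OF x that] ge by linarith
          show "measure_pmf.expectation f coord_sum \<le> of_int k + 1"
            using bernoulli_class_expectation_coord_sum[OF f] hi by simp
        qed
        with notin show False by simp
      next
        case 2
        then have "of_int s \<le> (of_int (k - 1) :: real)"
          by (simp only: of_int_le_iff)
        then have le: "coord_sum x \<le> of_int k - 1"
          using s by simp
        \<comment> \<open>Negation turns the upper bound on the sums into the lower bound that the
          lemma on means expects.\<close>
        have "- coord_sum x = - of_int k"
        proof (rule eq_on_set_pmf_if_expectation_le[OF bernoulli_class_integrable[OF f] _ _ x])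
          show "- of_int k \<le> - coord_sum y" if "y \<in> set_pmf f" for y
            using close[rule_format, OF x that] le by linarith
          show "measure_pmf.expectation f (\<lambda>x. - coord_sum x) \<le> - of_int k"
            using bernoulli_class_expectation_coord_sum[OF f] lo by simp
        qed
        with notin show False by simp
      qed
    qed
  next
    assume two: "\<forall>x\<in>set_pmf f. coord_sum x \<in> {of_int k, of_int k + 1}"
    show "\<forall>x\<in>set_pmf f. \<forall>y\<in>set_pmf f. \<bar>coord_sum x - coord_sum y\<bar> \<le> 1"
    proof (intro ballI)
      fix x y
      assume "x \<in> set_pmf f" "y \<in> set_pmf f"
      then have "coord_sum x \<in> {of_int k, of_int k + 1}" "coord_sum y \<in> {of_int k, of_int k + 1}"
        using two by blast+
      then show "\<bar>coord_sum x - coord_sum y\<bar> \<le> 1"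
        by (elim insertE emptyE) simp_all
    qed
  qed
  finally show ?thesis .
qed

section \<open>Convex order of the coordinate sums\<close>

text \<open>A convex function lies above the extension of a chord outside its interval, and no
  integer lies strictly between \<open>k\<close> and \<open>k + 1\<close>.\<close>

lemma convex_on_chord_le_int:
  fixes \<phi> :: "real \<Rightarrow> real" and k s :: int
  assumes "convex_on UNIV \<phi>"
  shows "\<phi> (of_int k) + (of_int s - of_int k) * (\<phi> (of_int k + 1) - \<phi> (of_int k)) \<le> \<phi> (of_int s)"
proof -
  consider "s < k" | "s = k" | "s = k + 1" | "s > k + 1"
    by linarith
  then show ?thesis
  proof cases
    case 1
    \<comment> \<open>Here \<open>k\<close> lies between \<open>s\<close> and \<open>k + 1\<close>,
      at distance 1 from \<open>k + 1\<close> out of \<open>d + 1\<close>; hence the weight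
      \<open>1 / (d + 1)\<close> of \<open>s\<close>.\<close>
    define d :: real where "d = of_int k - of_int s"
    have d: "d > 0" using 1 by (simp add: d_def)
    have "\<phi> ((1 - 1 / (d + 1)) *\<^sub>R (of_int k + 1) + (1 / (d + 1)) *\<^sub>R of_int s)
        \<le> (1 - 1 / (d + 1)) * \<phi> (of_int k + 1) + (1 / (d + 1)) * \<phi> (of_int s)"
      using d by (intro convex_onD[OF assms]) auto
    moreover have "(1 - 1 / (d + 1)) *\<^sub>R (of_int k + 1) + (1 / (d + 1)) *\<^sub>R of_int s = (of_int k :: real)"
    proof -
      have "(1 - 1 / (d + 1)) *\<^sub>R (of_int k + 1) + (1 / (d + 1)) *\<^sub>R of_int s =
          of_int k + 1 - 1 / (d + 1) * (of_int k - of_int s + 1)"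
        by (simp only: real_scaleR_def) (simp only: algebra_simps)
      then show ?thesis
        using d by (simp add: d_def)
    qed
    ultimately have "(d + 1) * \<phi> (of_int k) \<le> (d + 1) * ((1 - 1 / (d + 1)) * \<phi> (of_int k + 1) + (1 / (d + 1)) * \<phi> (of_int s))"
      using d by (intro mult_left_mono) auto
    also have "\<dots> = d * \<phi> (of_int k + 1) + \<phi> (of_int s)"
    proof -
      have "1 / (d + 1) * (d + 1) = 1"
        using d by simp
      then show ?thesis
        by algebra
    qed
    finally show ?thesis
      by (simp add: d_def algebra_simps)
  next
    case 4
    \<comment> \<open>Now \<open>k + 1\<close> lies between \<open>k\<close> and \<open>s\<close>,
      at distance 1 from \<open>k\<close> out of \<open>d\<close>.\<close>
    define d :: real where "d = of_int s - of_int k"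
    have d: "d > 1" using 4 unfolding d_def by linarith
    have "\<phi> ((1 - 1 / d) *\<^sub>R of_int k + (1 / d) *\<^sub>R of_int s)
        \<le> (1 - 1 / d) * \<phi> (of_int k) + (1 / d) * \<phi> (of_int s)"
      using d by (intro convex_onD[OF assms]) auto
    moreover have "(1 - 1 / d) *\<^sub>R of_int k + (1 / d) *\<^sub>R of_int s = (of_int k + 1 :: real)"
    proof -
      have "of_int s = of_int k + d"
        by (simp add: d_def)
      then show ?thesis
        unfolding real_scaleR_def using d by (simp only:) (simp add: field_simps)
    qed
    ultimately have "d * \<phi> (of_int k + 1) \<le> d * ((1 - 1 / d) * \<phi> (of_int k) + (1 / d) * \<phi> (of_int s))"
      using d by (intro mult_left_mono) auto
    also have "\<dots> = (d - 1) * \<phi> (of_int k) + \<phi> (of_int s)"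
      using d by (simp add: field_simps)
    finally show ?thesis
      by (simp add: d_def algebra_simps)
  qed auto
qed

text \<open>The chord is affine, so its expectation depends only on the mean of the sum, which all
  members of the class share. It agrees with the convex function on the sums of \<open>f\<close> and
  lies below it on those of \<open>g\<close>.\<close>

lemma Sigma_cx_smallest_if_two_sums:
  fixes f :: "(real ^ 'n) pmf" and k :: int
  assumes f: "f \<in> bernoulli_class p"
    and supp: "\<forall>x\<in>set_pmf f. coord_sum x \<in> {of_int k, of_int k + 1}"
  shows "Sigma_cx_smallest (bernoulli_class p) f"
  unfolding Sigma_cx_smallest_def convex_order_def
proof (intro conjI ballI allI impI f)
  fix g :: "(real ^ 'n) pmf" and \<phi> :: "real \<Rightarrow> real"
  assume g: "g \<in> bernoulli_class p" and cvx: "convex_on UNIV \<phi>"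
  let ?d = "\<phi> (of_int k + 1) - \<phi> (of_int k)"
  let ?chord = "\<lambda>t. \<phi> (of_int k) + (t - of_int k) * ?d"
  have chord: "measure_pmf.expectation h (\<lambda>x. ?chord (coord_sum x)) =
      ?chord (real CARD('n) * p)" if "h \<in> bernoulli_class p" for h :: "(real ^ 'n) pmf"
  proof -
    have "measure_pmf.expectation h (\<lambda>x. ?chord (coord_sum x)) =
        ?chord (measure_pmf.expectation h coord_sum)"
      by (simp add: bernoulli_class_integrable[OF that] del: Bochner_Integration.integral_sum)
    then show ?thesis
      by (simp only: bernoulli_class_expectation_coord_sum[OF that])
  qed
  have "measure_pmf.expectation f (\<lambda>x. \<phi> (coord_sum x)) =
      measure_pmf.expectation f (\<lambda>x. ?chord (coord_sum x))"
    using supp by (intro integral_cong_AE) (auto simp: AE_measure_pmf_iff)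
  also have "\<dots> = measure_pmf.expectation g (\<lambda>x. ?chord (coord_sum x))"
    by (simp only: chord[OF f] chord[OF g])
  also have "\<dots> \<le> measure_pmf.expectation g (\<lambda>x. \<phi> (coord_sum x))"
  proof (intro integral_mono_AE bernoulli_class_integrable[OF g])
    show "AE x in measure_pmf g. ?chord (coord_sum x) \<le> \<phi> (coord_sum x)"
      unfolding AE_measure_pmf_iff
    proof
      fix x
      assume "x \<in> set_pmf g"
      then obtain s :: int where "coord_sum x = of_int s"
        using coord_sum_bernoulli_class[OF g] by blast
      then show "?chord (coord_sum x) \<le> \<phi> (coord_sum x)"
        using convex_on_chord_le_int[OF cvx, of k s] by simp
    qed
  qed
  finally show "measure_pmf.expectation f (\<lambda>x. \<phi> (coord_sum x)) \<le>
      measure_pmf.expectation g (\<lambda>x. \<phi> (coord_sum x))" .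
qed (auto intro: bernoulli_class_integrable f)

text \<open>
  Conversely, the convex function \<open>\<lambda>t. \<bar>t - k\<bar> + \<bar>t - (k + 1)\<bar>\<close> is minimal exactly on
  \<open>[k, k + 1]\<close>, so it detects any mass outside.
\<close>

lemma two_sums_if_Sigma_cx_smallest:
  fixes f g :: "(real ^ 'n) pmf" and k :: int
  assumes small: "Sigma_cx_smallest (bernoulli_class p) f"
    and g: "g \<in> bernoulli_class p"
    and supp: "\<forall>x\<in>set_pmf g. coord_sum x \<in> {of_int k, of_int k + 1}"
  shows "\<forall>x\<in>set_pmf f. coord_sum x \<in> {of_int k, of_int k + 1}"
proof
  fix x
  assume x: "x \<in> set_pmf f"
  have f: "f \<in> bernoulli_class p"
    using small by (simp add: Sigma_cx_smallest_def)
  define \<phi> :: "real \<Rightarrow> real" where "\<phi> = (\<lambda>t. dist (of_int k) t + dist (of_int k + 1) t)"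
  have cvx: "convex_on UNIV \<phi>"
    unfolding \<phi>_def by (intro convex_on_add convex_on_dist) auto
  have "\<phi> (coord_sum x) = 1"
  proof (rule eq_on_set_pmf_if_expectation_le[OF bernoulli_class_integrable[OF f] _ _ x])
    show "1 \<le> \<phi> (coord_sum y)" for y :: "real ^ 'n"
      by (simp add: \<phi>_def dist_real_def)
    have "measure_pmf.expectation f (\<lambda>x. \<phi> (coord_sum x)) \<le>
        measure_pmf.expectation g (\<lambda>x. \<phi> (coord_sum x))"
      using small g cvx bernoulli_class_integrable[OF f] bernoulli_class_integrable[OF g]
      unfolding Sigma_cx_smallest_def convex_order_def by blast
    also have "\<dots> = measure_pmf.expectation g (\<lambda>x. 1)"
      using supp by (intro integral_cong_AE) (auto simp: AE_measure_pmf_iff \<phi>_def dist_real_def)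
    finally show "measure_pmf.expectation f (\<lambda>x. \<phi> (coord_sum x)) \<le> 1"
      by simp
  qed
  moreover obtain s :: int where s: "coord_sum x = of_int s"
    using coord_sum_bernoulli_class[OF f x] .
  \<comment> \<open>Over the reals the minimum 1 is attained on the whole interval; integrality of
    the sum leaves only its endpoints.\<close>
  ultimately have "of_int (\<bar>k - s\<bar> + \<bar>k + 1 - s\<bar>) = (of_int 1 :: real)"
    by (simp add: \<phi>_def dist_real_def)
  then have "\<bar>k - s\<bar> + \<bar>k + 1 - s\<bar> = 1"
    by (simp only: of_int_eq_iff)
  then have "s = k \<or> s = k + 1"
    by linarith
  then show "coord_sum x \<in> {of_int k, of_int k + 1}"
    using s by auto
qed

section \<open>Vectors with eight coordinates\<close>

lemma exhaust_8:
  fixes x :: 8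
  shows "x = 1 \<or> x = 2 \<or> x = 3 \<or> x = 4 \<or> x = 5 \<or> x = 6 \<or> x = 7 \<or> x = 8"
proof (induct x)
  case (of_int z)
  \<comment> \<open>Representatives run from 0 to 7, indices from 1 to 8; the numeral
    \<open>8\<close> equals \<open>0\<close> in the type \<open>8\<close>.\<close>
  then have "z = 0 \<or> z = 1 \<or> z = 2 \<or> z = 3 \<or> z = 4 \<or> z = 5 \<or> z = 6 \<or> z = 7" by fastforce
  then show ?case by auto
qed

lemma forall_8:
  "(\<forall>i::8. P i) \<longleftrightarrow> P 1 \<and> P 2 \<and> P 3 \<and> P 4 \<and> P 5 \<and> P 6 \<and> P 7 \<and> P 8"
  by (metis exhaust_8)

lemma sum_8:
  "sum f (UNIV :: 8 set) = f 1 + f 2 + f 3 + f 4 + f 5 + f 6 + f 7 + f 8"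
proof -
  have eq: "(UNIV :: 8 set) = {1, 2, 3, 4, 5, 6, 7, 8}"
    using exhaust_8 by auto
  show ?thesis
    unfolding eq by (simp add: ac_simps)
qed

lemma vector_8:
  "(vector [a,b,c,d,e,f,g,h] :: 'a::zero ^ 8) $ 1 = a"
  "(vector [a,b,c,d,e,f,g,h] :: 'a::zero ^ 8) $ 2 = b"
  "(vector [a,b,c,d,e,f,g,h] :: 'a::zero ^ 8) $ 3 = c"
  "(vector [a,b,c,d,e,f,g,h] :: 'a::zero ^ 8) $ 4 = d"
  "(vector [a,b,c,d,e,f,g,h] :: 'a::zero ^ 8) $ 5 = e"
  "(vector [a,b,c,d,e,f,g,h] :: 'a::zero ^ 8) $ 6 = f"
  "(vector [a,b,c,d,e,f,g,h] :: 'a::zero ^ 8) $ 7 = g"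
  "(vector [a,b,c,d,e,f,g,h] :: 'a::zero ^ 8) $ 8 = h"
  unfolding vector_def by simp_all

lemma vec8_eq_iff:
  "(x :: 'a ^ 8) = y \<longleftrightarrow> x $ 1 = y $ 1 \<and> x $ 2 = y $ 2 \<and> x $ 3 = y $ 3 \<and> x $ 4 = y $ 4 \<and>
     x $ 5 = y $ 5 \<and> x $ 6 = y $ 6 \<and> x $ 7 = y $ 7 \<and> x $ 8 = y $ 8"
  by (simp add: vec_eq_iff forall_8)

lemma vector_3_eq_iff:
  "(vector [a, b, c] :: 'a::zero ^ 3) = vector [a', b', c'] \<longleftrightarrow> a = a' \<and> b = b' \<and> c = c'"
  by (simp add: vec_eq_iff forall_3 vector_3)

section \<open>The trivariate class as a polytope of vectors\<close>

abbreviation cube3 :: "(real ^ 3) set" where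
  "cube3 \<equiv> {vector [0, 0, 0], vector [1, 0, 0], vector [0, 1, 0], vector [1, 1, 0],
     vector [0, 0, 1], vector [1, 0, 1], vector [0, 1, 1], vector [1, 1, 1]}"

lemma cube3_eq: "{x :: real ^ 3. \<forall>i. x $ i \<in> {0, 1}} = cube3"
proof -
  have "x \<in> cube3" if "\<forall>i. x $ i \<in> {0, 1}" for x :: "real ^ 3"
  proof -
    have "x $ 1 \<in> {0, 1}" "x $ 2 \<in> {0, 1}" "x $ 3 \<in> {0, 1}"
      using that by auto
    then show ?thesis
      by (auto simp: vec_eq_iff forall_3 vector_3)
  qed
  then show ?thesis
    by (auto simp: forall_3 vector_3)
qed

lemma sum_cube3:
  "sum h cube3 = h (vector [0, 0, 0]) + h (vector [1, 0, 0]) + h (vector [0, 1, 0]) +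
     h (vector [1, 1, 0]) + h (vector [0, 0, 1]) + h (vector [1, 0, 1]) +
     h (vector [0, 1, 1]) + (h (vector [1, 1, 1]) :: real)"
  by (simp add: vector_3_eq_iff)

text \<open>The point \<open>x\<close> has index \<open>1 + x1 + 2 * x2 + 4 * x3\<close>, so the
  equations state the total mass and then the three means, one per coordinate.\<close>

definition pmf_vecs :: "real \<Rightarrow> (real ^ 8) set" where
  "pmf_vecs p = {v. (\<forall>i. 0 \<le> v $ i) \<and>
     v $ 1 + v $ 2 + v $ 3 + v $ 4 + v $ 5 + v $ 6 + v $ 7 + v $ 8 = 1 \<and>
     v $ 2 + v $ 4 + v $ 6 + v $ 8 = p \<and>
     v $ 3 + v $ 4 + v $ 7 + v $ 8 = p \<and>
     v $ 5 + v $ 6 + v $ 7 + v $ 8 = p}"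

lemma pmf_vec_nth:
  "pmf_vec f $ 1 = pmf f (vector [0, 0, 0])" "pmf_vec f $ 2 = pmf f (vector [1, 0, 0])"
  "pmf_vec f $ 3 = pmf f (vector [0, 1, 0])" "pmf_vec f $ 4 = pmf f (vector [1, 1, 0])"
  "pmf_vec f $ 5 = pmf f (vector [0, 0, 1])" "pmf_vec f $ 6 = pmf f (vector [1, 0, 1])"
  "pmf_vec f $ 7 = pmf f (vector [0, 1, 1])" "pmf_vec f $ 8 = pmf f (vector [1, 1, 1])"
  unfolding pmf_vec_def vector_8 by simp_all

lemma expectation_cube3:
  fixes h :: "real ^ 3 \<Rightarrow> real"
  assumes "set_pmf f \<subseteq> cube3"
  shows "measure_pmf.expectation f h = (\<Sum>x\<in>cube3. h x * pmf f x)"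
  using assms by (intro integral_measure_pmf_real) auto

lemma bernoulli_class_3_iff:
  "f \<in> bernoulli_class p \<longleftrightarrow> set_pmf f \<subseteq> cube3 \<and> pmf_vec f \<in> pmf_vecs p"
proof -
  have "f \<in> bernoulli_class p \<longleftrightarrow> set_pmf f \<subseteq> cube3 \<and>
      (\<forall>i. measure_pmf.expectation f (\<lambda>x. x $ i) = p)"
    unfolding bernoulli_class_def cube3_eq by blast
  also have "\<dots> \<longleftrightarrow> set_pmf f \<subseteq> cube3 \<and> pmf_vec f \<in> pmf_vecs p"
  proof (rule conj_cong[OF refl])
    assume supp: "set_pmf f \<subseteq> cube3"
    \<comment> \<open>Nonnegativity and total mass hold for every pmf on the cube, so only the three
      means remain to be compared.\<close>
    have "(\<Sum>x\<in>cube3. pmf f x) = 1"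
      using supp by (intro sum_pmf_eq_1) auto
    then show "(\<forall>i. measure_pmf.expectation f (\<lambda>x. x $ i) = p) \<longleftrightarrow> pmf_vec f \<in> pmf_vecs p"
      unfolding expectation_cube3[OF supp] sum_cube3
      by (simp add: pmf_vecs_def pmf_vec_nth forall_3 forall_8 vector_3)
  qed
  finally show ?thesis .
qed

lemma ex_pmf_with_pmf_vec:
  assumes v: "v \<in> pmf_vecs p"
  shows "\<exists>f. set_pmf f \<subseteq> cube3 \<and> pmf_vec f = v"
proof -
  define xs :: "((real ^ 3) \<times> real) list" where
    "xs = [(vector [0, 0, 0], v $ 1), (vector [1, 0, 0], v $ 2), (vector [0, 1, 0], v $ 3),
       (vector [1, 1, 0], v $ 4), (vector [0, 0, 1], v $ 5), (vector [1, 0, 1], v $ 6),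
       (vector [0, 1, 1], v $ 7), (vector [1, 1, 1], v $ 8)]"
  have wf: "pmf_of_list_wf xs"
    using v by (auto simp: pmf_of_list_wf_def xs_def pmf_vecs_def)
  have "pmf_vec (pmf_of_list xs) = v"
    by (simp add: vec8_eq_iff pmf_vec_nth pmf_pmf_of_list[OF wf])
      (simp add: xs_def vector_3_eq_iff)
  moreover have "set_pmf (pmf_of_list xs) \<subseteq> cube3"
    using set_pmf_of_list[OF wf] by (simp add: xs_def)
  ultimately show ?thesis
    by blast
qed

lemma pmf_vec_image_bernoulli_class: "pmf_vec ` bernoulli_class p = pmf_vecs p"
proof
  show "pmf_vec ` bernoulli_class p \<subseteq> pmf_vecs p"
    by (auto simp only: bernoulli_class_3_iff)
  show "pmf_vecs p \<subseteq> pmf_vec ` bernoulli_class p"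
  proof
    fix v
    assume v: "v \<in> pmf_vecs p"
    then obtain f where "set_pmf f \<subseteq> cube3" "pmf_vec f = v"
      using ex_pmf_with_pmf_vec by blast
    with v show "v \<in> pmf_vec ` bernoulli_class p"
      by (metis bernoulli_class_3_iff imageI)
  qed
qed

text \<open>The cases \<open>k = 0\<close> and \<open>k = 1\<close>: the indices listed are those of
  the points of forbidden weight, namely 2 and 3, or 0 and 3.\<close>

lemma cube3_support_sums_iff:
  fixes f :: "(real ^ 3) pmf"
  assumes "set_pmf f \<subseteq> cube3"
  shows "(\<forall>x\<in>set_pmf f. (\<Sum>j\<in>UNIV. x $ j) \<in> {0, 1}) \<longleftrightarrow>
           pmf_vec f $ 4 = 0 \<and> pmf_vec f $ 6 = 0 \<and> pmf_vec f $ 7 = 0 \<and> pmf_vec f $ 8 = 0"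
    and "(\<forall>x\<in>set_pmf f. (\<Sum>j\<in>UNIV. x $ j) \<in> {1, 2}) \<longleftrightarrow> pmf_vec f $ 1 = 0 \<and> pmf_vec f $ 8 = 0"
proof -
  have *: "(\<forall>x\<in>set_pmf f. P x) \<longleftrightarrow> (\<forall>x\<in>cube3. pmf f x = 0 \<or> P x)" for P
    using assms by (meson subsetD set_pmf_iff)
  show "(\<forall>x\<in>set_pmf f. (\<Sum>j\<in>UNIV. x $ j) \<in> {0, 1}) \<longleftrightarrow>
           pmf_vec f $ 4 = 0 \<and> pmf_vec f $ 6 = 0 \<and> pmf_vec f $ 7 = 0 \<and> pmf_vec f $ 8 = 0"
    and "(\<forall>x\<in>set_pmf f. (\<Sum>j\<in>UNIV. x $ j) \<in> {1, 2}) \<longleftrightarrow> pmf_vec f $ 1 = 0 \<and> pmf_vec f $ 8 = 0"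
    unfolding * by (simp_all add: sum_3 vector_3 pmf_vec_nth)
qed

text \<open>
  A nonnegative solution of a linear system that is determined by its zero pattern is a basic
  solution, hence a vertex.
\<close>

lemma extreme_point_of_if_determined_by_zeros:
  fixes v :: "real ^ 'n"
  assumes "v \<in> S" and nonneg: "\<And>w i. w \<in> S \<Longrightarrow> 0 \<le> w $ i"
    and det: "\<And>w. w \<in> S \<Longrightarrow> (\<And>i. v $ i = 0 \<Longrightarrow> w $ i = 0) \<Longrightarrow> w = v"
  shows "v extreme_point_of S"
  unfolding extreme_point_of_def
proof (intro conjI ballI notI)
  fix a b
  assume a: "a \<in> S" and b: "b \<in> S" and "v \<in> open_segment a b"
  then obtain u where ne: "a \<noteq> b" and u: "0 < u" "u < 1" and v: "v = (1 - u) *\<^sub>R a + u *\<^sub>R b"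
    by (auto simp: in_segment)
  have "a $ i = 0 \<and> b $ i = 0" if "v $ i = 0" for i
  proof -
    \<comment> \<open>Two nonnegative terms with sum 0 both vanish, and both weights are
      positive.\<close>
    have "(1 - u) * a $ i + u * b $ i = 0"
      using that v by simp
    moreover have "0 \<le> (1 - u) * a $ i" "0 \<le> u * b $ i"
      using nonneg[OF a] nonneg[OF b] u by auto
    ultimately have "(1 - u) * a $ i = 0" "u * b $ i = 0"
      by linarith+
    then show ?thesis
      using u by simp
  qed
  then have "a = v" "b = v"
    using det a b by auto
  with ne show False by simp
qed fact

lemma inner_vector_8:
  "vector [a,b,c,d,e,f,g,h] \<bullet> (v :: real ^ 8) =
     a * v $ 1 + b * v $ 2 + c * v $ 3 + d * v $ 4 + e * v $ 5 + f * v $ 6 + g * v $ 7 + h * v $ 8"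
  by (simp add: inner_vec_def sum_8 vector_8)

lemma convex_pmf_vecs: "convex (pmf_vecs p)"
proof -
  have eq: "pmf_vecs p = (\<Inter>i. {v. 0 \<le> axis i 1 \<bullet> v}) \<inter>
      {v. vector [1, 1, 1, 1, 1, 1, 1, 1] \<bullet> v = 1} \<inter> {v. vector [0, 1, 0, 1, 0, 1, 0, 1] \<bullet> v = p} \<inter>
      {v. vector [0, 0, 1, 1, 0, 0, 1, 1] \<bullet> v = p} \<inter> {v. vector [0, 0, 0, 0, 1, 1, 1, 1] \<bullet> v = p}"
    by (auto simp: pmf_vecs_def inner_axis' inner_vector_8)
  show ?thesis
    unfolding eq by (intro convex_Int convex_INT convex_halfspace_ge convex_hyperplane)
qed

section \<open>Generators and the two ranges of the mean\<close>

text \<open>This reduces the theorem to a hull computation. Extreme points of a hull lie in its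
  generating set, and a vertex of the whole polytope stays extreme in any subset containing
  it.\<close>

lemma generators_if_Sigma_countermonotonic_eq_hull:
  fixes p :: real and k :: int and R :: "(real ^ 8) set"
  defines "F \<equiv> bernoulli_class p :: (real ^ 3) pmf set"
  defines "C \<equiv> pmf_vec ` {f \<in> F. Sigma_countermonotonic_pmf f}"
  assumes lo: "of_int k \<le> 3 * p" and hi: "3 * p \<le> of_int k + 1"
    and R: "finite R" "R \<noteq> {}" and hull: "C = convex hull R"
    and extreme: "\<And>r. r \<in> R \<Longrightarrow> r extreme_point_of pmf_vecs p"
  shows "polytope C" and "{v. v extreme_point_of C} = R"
    and "R = pmf_vec ` {f \<in> F. pmf_vec f extreme_point_of (pmf_vec ` F) \<and> Sigma_cx_smallest F f}"
proof -
  show "polytope C"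
    using R(1) hull by (auto simp: polytope_def)
  have F_vecs: "pmf_vec ` F = pmf_vecs p"
    by (simp add: F_def pmf_vec_image_bernoulli_class)
  have C_sub: "C \<subseteq> pmf_vecs p"
    unfolding F_vecs[symmetric] C_def by blast
  have R_sub: "R \<subseteq> C"
    unfolding hull by (rule hull_subset)
  have ext_C: "v extreme_point_of C" if "v \<in> C" "v extreme_point_of pmf_vecs p" for v
    using that C_sub by (auto simp: extreme_point_of_def)
  show G: "{v. v extreme_point_of C} = R"
    using extreme_point_of_convex_hull[of _ R] ext_C R_sub extreme unfolding hull by blast
  have cm_iff: "Sigma_countermonotonic_pmf f \<longleftrightarrow>
      (\<forall>x\<in>set_pmf f. coord_sum x \<in> {of_int k, of_int k + 1})" if "f \<in> F" for f
    using Sigma_countermonotonic_pmf_iff[of f p k] that lo hi by (simp add: F_def)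
  \<comment> \<open>Nonemptiness of \<open>R\<close> supplies the competitor with sums in
    \<open>{k, k + 1}\<close> against which a smallest element is compared.\<close>
  obtain g where g: "g \<in> F" "Sigma_countermonotonic_pmf g"
    using R(2) R_sub unfolding C_def by blast
  have small_iff: "Sigma_cx_smallest F f \<longleftrightarrow> Sigma_countermonotonic_pmf f" if "f \<in> F" for f
    using Sigma_cx_smallest_if_two_sums[of f p k] two_sums_if_Sigma_cx_smallest[of p f g k]
      cm_iff[OF that] cm_iff[OF g(1)] g that unfolding F_def by blast
  have "pmf_vec ` {f \<in> F. pmf_vec f extreme_point_of (pmf_vec ` F) \<and> Sigma_cx_smallest F f} =
      {v \<in> C. v extreme_point_of pmf_vecs p}"
    unfolding F_vecs C_def using small_iff by auto
  also have "\<dots> = R"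
    using G ext_C R_sub extreme by blast
  finally show "R = pmf_vec ` {f \<in> F. pmf_vec f extreme_point_of (pmf_vec ` F) \<and> Sigma_cx_smallest F f}" ..
qed

text \<open>With \<open>P\<close> the vanishing of the entries of forbidden weight, the
  countermonotonic pmfs become a slice of \<open>pmf_vecs p\<close> by coordinate
  hyperplanes.\<close>

lemma Sigma_countermonotonic_pmf_vecs_eq:
  fixes p :: real and k :: int
  assumes "of_int k \<le> 3 * p" "3 * p \<le> of_int k + 1"
    and "\<And>f :: (real ^ 3) pmf. set_pmf f \<subseteq> cube3 \<Longrightarrow>
      (\<forall>x\<in>set_pmf f. coord_sum x \<in> {of_int k, of_int k + 1}) \<longleftrightarrow> P (pmf_vec f)"
  shows "pmf_vec ` {f \<in> bernoulli_class p. Sigma_countermonotonic_pmf f} = {v \<in> pmf_vecs p. P v}"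
proof -
  have "Sigma_countermonotonic_pmf f \<longleftrightarrow> P (pmf_vec f)" if "f \<in> bernoulli_class p" for f
  proof -
    have "set_pmf f \<subseteq> cube3"
      using that by (simp only: bernoulli_class_3_iff)
    then show ?thesis
      using Sigma_countermonotonic_pmf_iff[OF that, of k] assms by simp
  qed
  then have "pmf_vec ` {f \<in> bernoulli_class p. Sigma_countermonotonic_pmf f} =
      {v \<in> pmf_vec ` bernoulli_class p. P v}"
    by auto
  then show ?thesis
    by (simp only: pmf_vec_image_bernoulli_class)
qed

theorem proposition3p4:
  fixes p :: real
  assumes "p \<in> \<rat>" and "0 < p" and "p \<le> 1 / 2"
  shows
    "let F = (bernoulli_class p :: (real ^ 3) pmf set);
         C = pmf_vec ` {f \<in> F. Sigma_countermonotonic_pmf f};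
         G = {v. v extreme_point_of C};
         r6 = vector [0, 1 - 2 * p, 1 - 2 * p, 3 * p - 1, p, 0, 0, 0];
         r7 = vector [0, 1 - 2 * p, p, 0, 1 - 2 * p, 3 * p - 1, 0, 0];
         r8 = vector [0, p, 1 - 2 * p, 0, 1 - 2 * p, 0, 3 * p - 1, 0]
     in polytope C \<and>
        G = pmf_vec ` {f \<in> F. pmf_vec f extreme_point_of (pmf_vec ` F) \<and> Sigma_cx_smallest F f} \<and>
        (p \<le> 1 / 3 \<longrightarrow> G = {vector [1 - 3 * p, p, p, 0, p, 0, 0, 0]}) \<and>
        (1 / 3 < p \<longrightarrow> G = {r6, r7, r8} \<and> card G = 3)"
proof -
  define F where "F = (bernoulli_class p :: (real ^ 3) pmf set)"
  define C where "C = pmf_vec ` {f \<in> F. Sigma_countermonotonic_pmf f}"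
  define G where "G = {v. v extreme_point_of C}"
  define r where "r = (vector [1 - 3 * p, p, p, 0, p, 0, 0, 0] :: real ^ 8)"
  define r6 where "r6 = (vector [0, 1 - 2 * p, 1 - 2 * p, 3 * p - 1, p, 0, 0, 0] :: real ^ 8)"
  define r7 where "r7 = (vector [0, 1 - 2 * p, p, 0, 1 - 2 * p, 3 * p - 1, 0, 0] :: real ^ 8)"
  define r8 where "r8 = (vector [0, p, 1 - 2 * p, 0, 1 - 2 * p, 0, 3 * p - 1, 0] :: real ^ 8)"
  note defs = r_def r6_def r7_def r8_def
  define R where "R = (if p \<le> 1 / 3 then {r} else {r6, r7, r8})"
  \<comment> \<open>At \<open>p = 1 / 3\<close> both values of \<open>k\<close> satisfy the bounds;
    the choice follows the case split of the claim.\<close>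
  define k :: int where "k = (if p \<le> 1 / 3 then 0 else 1)"
  have lo: "of_int k \<le> 3 * p" and hi: "3 * p \<le> of_int k + 1"
    using assms by (auto simp: k_def)
  have nonneg: "0 \<le> w $ i" if "w \<in> pmf_vecs p" for w i
    using that by (simp add: pmf_vecs_def)
  have extreme: "v extreme_point_of pmf_vecs p" if "v \<in> R" for v
  proof (rule extreme_point_of_if_determined_by_zeros[OF _ nonneg])
    show "v \<in> pmf_vecs p"
      using that assms by (auto simp: R_def defs pmf_vecs_def forall_8 vector_8 split: if_splits)
    fix w
    assume w: "w \<in> pmf_vecs p" and zeros: "\<And>i. v $ i = 0 \<Longrightarrow> w $ i = 0"
    \<comment> \<open>Each candidate has at least four zeros among these five entries, and the four
      equations of \<open>pmf_vecs\<close> fix the rest.\<close>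
    show "w = v"
      using that w zeros[of 1] zeros[of 4] zeros[of 6] zeros[of 7] zeros[of 8]
      by (auto simp: R_def defs pmf_vecs_def vec8_eq_iff vector_8 split: if_splits)
  qed
  have hull: "C = convex hull R"
  proof (cases "p \<le> 1 / 3")
    case True
    have "C = {v \<in> pmf_vecs p. v $ 4 = 0 \<and> v $ 6 = 0 \<and> v $ 7 = 0 \<and> v $ 8 = 0}"
      unfolding C_def F_def
      using Sigma_countermonotonic_pmf_vecs_eq[OF lo hi] cube3_support_sums_iff(1) True
      by (simp add: k_def)
    \<comment> \<open>Without mass on weights 2 and 3, the means put mass \<open>p\<close> on each
      unit vector and the remainder at the origin.\<close>
    also have "\<dots> = {r}"
      using True assms
      by (auto simp: r_def pmf_vecs_def vec8_eq_iff forall_8 vector_8)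
    finally show ?thesis
      using True by (simp add: R_def)
  next
    case False
    have "C = {v \<in> pmf_vecs p. v $ 1 = 0 \<and> v $ 8 = 0}"
      unfolding C_def F_def
      using Sigma_countermonotonic_pmf_vecs_eq[OF lo hi] cube3_support_sums_iff(2) False
      by (simp add: k_def)
    also have "\<dots> = convex hull {r6, r7, r8}"
    proof
      \<comment> \<open>With masses \<open>A\<close> and \<open>B\<close> on weights 1 and 2,
        \<open>A + B = 1\<close> and \<open>A + 2 * B = 3 * p\<close> give
        \<open>B = q\<close>.\<close>
      define q where "q = 3 * p - 1"
      have q: "q > 0"
        using False by (simp add: q_def)
      show "{v \<in> pmf_vecs p. v $ 1 = 0 \<and> v $ 8 = 0} \<subseteq> convex hull {r6, r7, r8}"
      proof
        fix v
        assume "v \<in> {v \<in> pmf_vecs p. v $ 1 = 0 \<and> v $ 8 = 0}"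
        then have v: "v \<in> pmf_vecs p" and z: "v $ 1 = 0" "v $ 8 = 0"
          by auto
        \<comment> \<open>The entries of weight 1 come from subtracting two of the mean equations
          from the total mass.\<close>
        have sum: "v $ 4 + v $ 6 + v $ 7 = q"
          and a: "v $ 2 = 1 - 2 * p + v $ 7" "v $ 3 = 1 - 2 * p + v $ 6" "v $ 5 = 1 - 2 * p + v $ 4"
          using v z by (auto simp: pmf_vecs_def q_def)
        \<comment> \<open>Each of \<open>r6\<close>, \<open>r7\<close>, \<open>r8\<close> has
          \<open>q\<close> at one of the positions 4, 6, 7 and 0 at the other two, so these ratios
          are the barycentric coordinates.\<close>
        define a b c where "a = v $ 4 / q" and "b = v $ 6 / q" and "c = v $ 7 / q"
        have abc: "v $ 4 = a * q" "v $ 6 = b * q" "v $ 7 = c * q"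
          using q by (simp_all add: a_def b_def c_def)
        have abc1: "a + b + c = 1"
          using sum q by (simp add: a_def b_def c_def add_divide_distrib[symmetric])
        have "v = a *\<^sub>R r6 + b *\<^sub>R r7 + c *\<^sub>R r8"
        proof -
          have c: "c = 1 - a - b"
            using abc1 by simp
          show ?thesis
            using abc a z unfolding c
            by (simp add: vec8_eq_iff defs vector_8 q_def algebra_simps)
        qed
        moreover have "0 \<le> a" "0 \<le> b" "0 \<le> c"
          using nonneg[OF v] q by (simp_all add: a_def b_def c_def)
        ultimately show "v \<in> convex hull {r6, r7, r8}"
          using abc1 unfolding convex_hull_3 by blast
      qed
      show "convex hull {r6, r7, r8} \<subseteq> {v \<in> pmf_vecs p. v $ 1 = 0 \<and> v $ 8 = 0}"
      proof (rule hull_minimal)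
        show "{r6, r7, r8} \<subseteq> {v \<in> pmf_vecs p. v $ 1 = 0 \<and> v $ 8 = 0}"
          using False assms by (auto simp: defs pmf_vecs_def forall_8 vector_8)
        show "convex {v \<in> pmf_vecs p. v $ 1 = 0 \<and> v $ 8 = 0}"
          using convex_pmf_vecs[of p] by (auto simp: convex_def)
      qed
    qed
    finally show ?thesis
      using False by (simp add: R_def)
  qed
  have R: "finite R" "R \<noteq> {}"
    by (simp_all add: R_def)
  note generators = generators_if_Sigma_countermonotonic_eq_hull
    [OF lo hi R hull[unfolded C_def F_def] extreme, folded F_def, folded C_def, folded G_def]
  have "card {r6, r7, r8} = 3" if "1 / 3 < p"
  proof -
    \<comment> \<open>The position of the nonzero entry \<open>3 * p - 1\<close> tells the three
      vectors apart.\<close>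
    have "r6 \<noteq> r7" "r6 \<noteq> r8" "r7 \<noteq> r8"
      using that by (auto simp: vec8_eq_iff defs vector_8)
    then show ?thesis
      by simp
  qed
  then have "polytope C \<and>
        G = pmf_vec ` {f \<in> F. pmf_vec f extreme_point_of (pmf_vec ` F) \<and> Sigma_cx_smallest F f} \<and>
        (p \<le> 1 / 3 \<longrightarrow> G = {r}) \<and>
        (1 / 3 < p \<longrightarrow> G = {r6, r7, r8} \<and> card G = 3)"
    using generators by (auto simp: R_def)
  then show ?thesis
    unfolding Let_def G_def C_def F_def defs .
qed

end
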